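(* There exist absolute constants $c,K>0$ (with $c$ in particular so large that $\log\log\frac mn>0$ whenever $m\ge cn$) such that for all $n,m\in\mathbb N$ with $m\ge cn$, $$e^{\mathrm{ran}}(n,\ell_1^m\hookrightarrow\ell_2^m)\ \le\ K\sqrt{\frac{\log\log\frac mn}{n}} .$$
   Context: $\ell_p^m$ is $\mathbb R^m$ with the $p$-norm, and $\ell_1^m\hookrightarrow\ell_2^m$ denotes the identity map $x\mapsto x$ from $\ell_1^m$ to $\ell_2^m$. $\log$ is the natural logarithm. Let $S:F\to G$ be a bounded linear operator between Banach spaces. A randomized algorithm (in general adaptive) with cost (at most) $n$ is a family $A_n=(A_n^\omega)_{\omega\in\Omega}=(\phi^\omega\circ N^\omega)_{\omega\in\Omega}$ indexed by a complete probability space $(\Omega,\mathcal A,\mathbb P)$, with an information map $N^\omega:F\to\mathbb R^n$ and an arbitrary (possibly non-linear) reconstruction map $\phi^\omega:\mathbb R^n\to G$. Here $N^\omega(f)=(y_1,\dots,y_n)$ with $y_1=L_1^\omega(f)$, $L_1^\omega\in F'$, and for $k=2,\dots,n$, $y_k=L_k^\omega(f;y_1,\dots,y_{k-1})$ where $L_k^\omega(\cdot\,;y_1,\dots,y_{k-1})\in F'$ is a bounded linear functional that may depend on the previously obtained information. Measurability is assumed: the maps $\Omega\times\mathbb R^{k-1}\to F'$ selecting the $k$-th functional are Borel measurable, and $\phi:\Omega\times\mathbb R^n\to G$ is measurable, so that $N:\Omega\times F\to\mathbb R^n$ and $A_n:\Omega\times F\to G$ are measurable. The minimal error is $$e^{\mathrm{ran}}(n,S):=\inf_{A_n}\sup_{\|f\|_F\le1}\mathbb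 E\,\|A_n(f)-S(f)\|_G ,$$ the infimum being over all such randomized algorithms of cost at most $n$. *)

theory Defs
  imports "HOL-Probability.Probability" "HOL-Analysis.Finite_Function_Topology"
begin

text \<open>
  The dimension \<open>m\<close> of \<open>\<ell>\<^sub>p\<^sup>m\<close> is quantified inside the theorem, so a normed space is given by a
  linear subspace of an ambient vector space together with a norm on it, and not by a type class.
  Vectors outside \<open>vecs F\<close> are irrelevant.
\<close>

record 'v nspace =
  vecs :: "'v set"
  vnorm :: "'v \<Rightarrow> real"

text \<open>Only the difference of vectors is needed here, so this also applies to \<open>dual_nspace F\<close>.\<close>

definition borel_nspace :: "'v::minus nspace \<Rightarrow> 'v measure" where
  "borel_nspace F =
     sigma (vecs F)
       {U. U \<subseteq> vecs F \<and> (\<forall>x\<in>U. \<exists>e>0. \<forall>y\<in>vecs F. vnorm F (y - x) < e \<longrightarrow> y \<in> U)}"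

text \<open>Functionals are extensional, so that each one is represented by a single HOL function.\<close>

definition dual_nspace :: "'a::real_vector nspace \<Rightarrow> ('a \<Rightarrow> real) nspace" where
  "dual_nspace F =
     \<lparr> vecs = {l \<in> extensional (vecs F).
                 (\<forall>x\<in>vecs F. \<forall>y\<in>vecs F. l (x + y) = l x + l y) \<and>
                 (\<forall>r. \<forall>x\<in>vecs F. l (r *\<^sub>R x) = r * l x) \<and>
                 (\<exists>B. \<forall>x\<in>vecs F. \<bar>l x\<bar> \<le> B * vnorm F x)},
       vnorm = (\<lambda>l. SUP x\<in>{x \<in> vecs F. vnorm F x \<le> 1}. \<bar>l x\<bar>) \<rparr>"

text \<open>
  \<open>\<ell>\<^sub>p\<^sup>m\<close>, where \<open>\<real>\<^sup>m\<close> is realised as the set of finitely supported sequences supported in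
  \<open>{0, \<dots>, m - 1}\<close>.
\<close>

definition lp :: "real \<Rightarrow> nat \<Rightarrow> (nat \<Rightarrow>\<^sub>0 real) nspace" where
  "lp p m =
     \<lparr> vecs = {x. Poly_Mapping.keys x \<subseteq> {..<m}},
       vnorm = (\<lambda>x. (\<Sum>i<m. \<bar>Poly_Mapping.lookup x i\<bar> powr p) powr (1 / p)) \<rparr>"

text \<open>\<open>\<real>\<^sup>k\<close> with its Borel sets; its points are the functions that are undefined outside \<open>{..<k}\<close>.\<close>

abbreviation borel_Rn :: "nat \<Rightarrow> (nat \<Rightarrow> real) measure" where
  "borel_Rn k \<equiv> Pi\<^sub>M {..<k} (\<lambda>_. borel)"

text \<open>
  With indices starting at 0, \<open>l k (\<omega>, y)\<close> is the functional chosen after the values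
  \<open>y 0, \<dots>, y (k - 1)\<close> have been observed.
\<close>

primrec information ::
  "(nat \<Rightarrow> 'w \<times> (nat \<Rightarrow> real) \<Rightarrow> 'a \<Rightarrow> real) \<Rightarrow> 'w \<Rightarrow> 'a \<Rightarrow> nat \<Rightarrow> (nat \<Rightarrow> real)" where
  "information l \<omega> f 0 = (\<lambda>_. undefined)"
| "information l \<omega> f (Suc k) =
     (information l \<omega> f k)(k := l k (\<omega>, information l \<omega> f k) f)"

definition rand_algorithm ::
  "nat \<Rightarrow> 'a::real_vector nspace \<Rightarrow> 'b::real_vector nspace \<Rightarrow> 'w measure \<Rightarrow>
   (nat \<Rightarrow> 'w \<times> (nat \<Rightarrow> real) \<Rightarrow> 'a \<Rightarrow> real) \<Rightarrow> ('w \<times> (nat \<Rightarrow> real) \<Rightarrow> 'b) \<Rightarrow> bool" where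
  "rand_algorithm n F G M l \<phi> \<longleftrightarrow>
     prob_space M \<and> complete_measure M \<and>
     (\<forall>k<n. l k \<in> measurable (M \<Otimes>\<^sub>M borel_Rn k) (borel_nspace (dual_nspace F))) \<and>
     \<phi> \<in> measurable (M \<Otimes>\<^sub>M borel_Rn n) (borel_nspace G)"

definition alg_output ::
  "nat \<Rightarrow> (nat \<Rightarrow> 'w \<times> (nat \<Rightarrow> real) \<Rightarrow> 'a \<Rightarrow> real) \<Rightarrow> ('w \<times> (nat \<Rightarrow> real) \<Rightarrow> 'b) \<Rightarrow>
   'w \<Rightarrow> 'a \<Rightarrow> 'b" where
  "alg_output n l \<phi> \<omega> f = \<phi> (\<omega>, information l \<omega> f n)"

definition alg_error ::
  "'a::real_vector nspace \<Rightarrow> 'b::real_vector nspace \<Rightarrow> ('a \<Rightarrow> 'b) \<Rightarrow> 'w measure \<Rightarrow>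
   ('w \<Rightarrow> 'a \<Rightarrow> 'b) \<Rightarrow> ennreal" where
  "alg_error F G S M A =
     (SUP f\<in>{f \<in> vecs F. vnorm F f \<le> 1}. \<integral>\<^sup>+ \<omega>. ennreal (vnorm G (A \<omega> f - S f)) \<partial>M)"

text \<open>
  Intended for Banach spaces \<open>F\<close>, \<open>G\<close> and a bounded linear operator \<open>S\<close>. HOL cannot quantify over
  the type of the sample space inside a term, hence the type argument. The underlying set of the
  probability space, its sigma-algebra and its measure remain arbitrary.
\<close>

definition e_ran ::
  "'w itself \<Rightarrow> nat \<Rightarrow> 'a::real_vector nspace \<Rightarrow> 'b::real_vector nspace \<Rightarrow> ('a \<Rightarrow> 'b) \<Rightarrow> ennreal" where
  "e_ran _ n F G S =
     Inf {alg_error F G S M (alg_output n l \<phi>) | (M :: 'w measure) l \<phi>. rand_algorithm n F G M l \<phi>}"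

text \<open>
  The minimal error of the identity \<open>\<ell>\<^sub>p\<^sup>m \<hookrightarrow> \<ell>\<^sub>q\<^sup>m\<close>. The sample spaces are carried by sets of real
  sequences. This type has the cardinality of the continuum, so every standard Borel probability
  space (completed) occurs up to isomorphism. As \<open>\<ell>\<^sub>q\<^sup>m\<close> and the dual of \<open>\<ell>\<^sub>p\<^sup>m\<close> are separable, other
  sample spaces do not change the infimum.
\<close>

definition e_ran_id :: "nat \<Rightarrow> real \<Rightarrow> real \<Rightarrow> nat \<Rightarrow> ennreal" where
  "e_ran_id n p q m = e_ran TYPE(nat \<Rightarrow> real) n (lp p m) (lp q m) (\<lambda>x. x)"

end

theory Submission
  imports Defs "HOL-Combinatorics.Permutations"
begin

text \<open>
  The algorithm places the \<open>m\<close> coordinates at random positions: a uniformly distributed permutation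
  \<open>\<pi>\<close> of \<open>N \<ge> m\<close> positions is drawn, and the positions are split into \<open>k\<close> consecutive buckets of equal
  size. In each bucket, \<open>2 * J + 1\<close> measurements search for one large coordinate. The bucket is split
  into nested cells of quickly decreasing size. For the current cell, let \<open>u\<close> be the sum of its
  coordinates and \<open>v\<close> the sum of its coordinates weighted with the numbers of their subcells. If
  one coordinate \<open>f i\<close> dominates the sum of the absolute values of all others in the cell by a
  factor larger than twice the number \<open>B\<close> of subcells, then \<open>v / u\<close> rounds to the number of the subcell
  of \<open>i\<close> (lemma \<open>round_ratio\<close>), which becomes the next current cell. Cells of the last level are
  single positions, so there \<open>u\<close> is the exact value of a coordinate. Hence the output agrees
  with \<open>f\<close> on the recovered coordinates and vanishes on all others, and the squared error is the sum
  of \<open>(f i)\<^sup>2\<close> over the coordinates \<open>i\<close> that are not recovered.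

  The whole analysis uses first moments only. Two given coordinates share a cell of size \<open>d\<close> with
  probability at most \<open>d / N\<close> (\<open>card_collisions_le\<close>), so for \<open>\<parallel>f\<parallel>\<^sub>1 \<le> 1\<close> the expected noise around \<open>i\<close>
  at that level is at most \<open>d / N\<close>. By Markov's inequality, the search for \<open>i\<close> fails at level \<open>j\<close>
  with probability at most \<open>2 * B\<^sub>j * d\<^sub>j / (N * \<bar>f i\<bar>)\<close>. With \<open>B\<^sub>j = 2 ^ (1 + 2 ^ j)\<close> these bounds decrease
  geometrically in \<open>j\<close>, so that \<open>i\<close> is lost with probability at most \<open>16 / (k * \<bar>f i\<bar>)\<close>
  (\<open>card_lost_le\<close>). The expected squared error is therefore at most
  \<open>(\<Sum>i. (f i)\<^sup>2 * 16 / (k * \<bar>f i\<bar>)) \<le> 16 / k\<close>, and the expected error at most \<open>4 / sqrt k\<close> by the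
  Cauchy-Schwarz inequality (\<open>e_ran_id_le_sqrt\<close>).

  As the number of cells grows doubly exponentially with the level, \<open>J\<close> of order \<open>ln (ln (m / n))\<close>
  levels suffice for buckets of size about \<open>m / k\<close>, and \<open>n\<close> measurements allow for
  \<open>k = n div (2 * J + 1)\<close> buckets. If there is not even one bucket, then the claimed bound is at least 1
  and holds because no output has an error above 1 (\<open>e_ran_id_le_1\<close>).
\<close>

section \<open>Sequence spaces and measurability\<close>

lemma vecs_lp: "vecs (lp p m) = {x. Poly_Mapping.keys x \<subseteq> {..<m}}"
  by (simp add: lp_def)

lemma vnorm_lp_1: "vnorm (lp 1 m) x = (\<Sum>i<m. \<bar>Poly_Mapping.lookup x i\<bar>)"
  by (simp add: lp_def sum_nonneg)

lemma vnorm_lp_2: "vnorm (lp 2 m) x = sqrt (\<Sum>i<m. (Poly_Mapping.lookup x i)\<^sup>2)"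
  by (simp add: lp_def sum_nonneg powr_half_sqrt)

lemma space_borel_nspace: "space (borel_nspace F) = vecs F"
  unfolding borel_nspace_def by (rule space_measure_of) auto

text \<open>
  The functional with coefficients \<open>w\<close>, in the extensional form required of elements of the dual.
\<close>

definition weighted_sum :: "nat \<Rightarrow> (nat \<Rightarrow> real) \<Rightarrow> (nat \<Rightarrow>\<^sub>0 real) \<Rightarrow> real" where
  "weighted_sum m w = (\<lambda>f\<in>vecs (lp 1 m). \<Sum>i<m. w i * Poly_Mapping.lookup f i)"

lemma lookup_scaleR [simp]: "Poly_Mapping.lookup (r *\<^sub>R x) i = r * Poly_Mapping.lookup x i"
  for x :: "'a \<Rightarrow>\<^sub>0 real"
proof -
  have "finite {i. r *\<^sub>R Poly_Mapping.lookup x i \<noteq> 0}"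
    by (rule finite_subset[of _ "Poly_Mapping.keys x"]) (auto simp: in_keys_iff)
  then show ?thesis
    unfolding scaleR_poly_mapping_def by (subst Abs_poly_mapping_inverse) auto
qed

lemma weighted_sum_in_dual: "weighted_sum m w \<in> vecs (dual_nspace (lp 1 m))"
proof -
  have add: "x + y \<in> vecs (lp 1 m)" if "x \<in> vecs (lp 1 m)" "y \<in> vecs (lp 1 m)" for x y
    using that Poly_Mapping.keys_add[of x y] by (auto simp: vecs_lp)
  have scale: "r *\<^sub>R x \<in> vecs (lp 1 m)" if "x \<in> vecs (lp 1 m)" for r x
    using that by (auto simp: vecs_lp subset_iff in_keys_iff)
  have "\<bar>weighted_sum m w x\<bar> \<le> (\<Sum>i<m. \<bar>w i\<bar>) * vnorm (lp 1 m) x" if "x \<in> vecs (lp 1 m)" for x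
  proof -
    have "\<bar>Poly_Mapping.lookup x i\<bar> \<le> vnorm (lp 1 m) x" if "i < m" for i
      unfolding vnorm_lp_1 using that by (intro member_le_sum) auto
    then have "(\<Sum>i<m. \<bar>w i * Poly_Mapping.lookup x i\<bar>) \<le> (\<Sum>i<m. \<bar>w i\<bar> * vnorm (lp 1 m) x)"
      by (intro sum_mono) (auto simp: abs_mult intro!: mult_left_mono)
    then have "\<bar>\<Sum>i<m. w i * Poly_Mapping.lookup x i\<bar> \<le> (\<Sum>i<m. \<bar>w i\<bar> * vnorm (lp 1 m) x)"
      by (rule order_trans[OF sum_abs])
    then show ?thesis
      using that by (simp add: weighted_sum_def sum_distrib_right)
  qed
  moreover have "weighted_sum m w \<in> extensional (vecs (lp 1 m))"
    by (simp add: weighted_sum_def)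
  moreover have "weighted_sum m w (x + y) = weighted_sum m w x + weighted_sum m w y"
    if "x \<in> vecs (lp 1 m)" "y \<in> vecs (lp 1 m)" for x y
    using that add[OF that] by (simp add: weighted_sum_def lookup_add distrib_left sum.distrib)
  moreover have "weighted_sum m w (r *\<^sub>R x) = r * weighted_sum m w x"
    if "x \<in> vecs (lp 1 m)" for r x
    using that scale[OF that] by (simp add: weighted_sum_def sum_distrib_left mult.left_commute)
  ultimately show ?thesis
    unfolding dual_nspace_def by auto
qed

text \<open>
  The point of \<open>\<real>\<^sup>m\<close> with coordinates \<open>z 0, \<dots>, z (m - 1)\<close>.
\<close>

definition fin_vec :: "nat \<Rightarrow> (nat \<Rightarrow> real) \<Rightarrow> (nat \<Rightarrow>\<^sub>0 real)" where
  "fin_vec m z = Abs_poly_mapping (\<lambda>i. if i < m then z i else 0)"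

lemma lookup_fin_vec [simp]: "Poly_Mapping.lookup (fin_vec m z) i = (if i < m then z i else 0)"
proof -
  have "finite {i. (if i < m then z i else 0) \<noteq> 0}"
    by (rule finite_subset[of _ "{..<m}"]) auto
  then show ?thesis
    unfolding fin_vec_def by (subst Abs_poly_mapping_inverse) auto
qed

lemma fin_vec_in_vecs: "fin_vec m z \<in> vecs (lp p m)"
  by (auto simp: vecs_lp in_keys_iff split: if_splits)

text \<open>
  Coordinatewise measurability suffices for the Borel sets of \<open>\<ell>\<^sub>2\<^sup>m\<close>, because \<open>fin_vec m\<close> is continuous
  on the space of all real sequences with the product topology, whose Borel sets are generated by
  the coordinates.
\<close>

lemma measurable_fin_vec:
  assumes "\<And>i. i < m \<Longrightarrow> (\<lambda>y. z y i) \<in> borel_measurable N"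
  shows "(\<lambda>y. fin_vec m (z y)) \<in> measurable N (borel_nspace (lp 2 m))"
proof -
  have "fin_vec m \<in> measurable borel (borel_nspace (lp 2 m))"
    unfolding borel_nspace_def
  proof (rule measurable_measure_of)
    fix U assume U: "U \<in> {U. U \<subseteq> vecs (lp 2 m) \<and>
      (\<forall>x\<in>U. \<exists>e>0. \<forall>y\<in>vecs (lp 2 m). vnorm (lp 2 m) (y - x) < e \<longrightarrow> y \<in> U)}"
    have "open (fin_vec m -` U)"
    proof (rule Topological_Spaces.openI)
      fix z0 assume "z0 \<in> fin_vec m -` U"
      then obtain e where e: "e > 0"
        "\<And>y. y \<in> vecs (lp 2 m) \<Longrightarrow> vnorm (lp 2 m) (y - fin_vec m z0) < e \<Longrightarrow> y \<in> U"
        using U by blast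
      define T where "T = {z :: nat \<Rightarrow> real. sqrt (\<Sum>i<m. (z i - z0 i)\<^sup>2) < e}"
      have "open T"
        unfolding T_def by (intro open_Collect_less continuous_intros continuous_on_product_coordinates)
      moreover have "z0 \<in> T"
        using e by (simp add: T_def)
      moreover have "T \<subseteq> fin_vec m -` U"
        by (auto simp: T_def vnorm_lp_2 lookup_minus intro!: e fin_vec_in_vecs)
      ultimately show "\<exists>T. open T \<and> z0 \<in> T \<and> T \<subseteq> fin_vec m -` U"
        by blast
    qed
    then show "fin_vec m -` U \<inter> space borel \<in> sets borel"
      by simp
  qed (auto intro: fin_vec_in_vecs)
  moreover have "(\<lambda>y i. if i < m then z y i else 0) \<in> measurable N borel"
  proof (rule measurable_coordinatewise_then_product)
    show "(\<lambda>y. if i < m then z y i else 0) \<in> borel_measurable N" for i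
      using assms by (cases "i < m") auto
  qed
  ultimately have "(\<lambda>y. fin_vec m (\<lambda>i. if i < m then z y i else 0)) \<in> measurable N (borel_nspace (lp 2 m))"
    by (rule measurable_compose[rotated])
  moreover have "fin_vec m (\<lambda>i. if i < m then z y i else 0) = fin_vec m (z y)" for y
    by (rule poly_mapping_eqI) simp
  ultimately show ?thesis
    by simp
qed

section \<open>Collisions of a random permutation\<close>

definition perms :: "nat \<Rightarrow> (nat \<Rightarrow> nat) set" where
  "perms N = {\<pi>. \<pi> permutes {..<N}}"

lemma finite_perms [simp]: "finite (perms N)"
  by (simp add: perms_def finite_permutations)

lemma card_perms [simp]: "card (perms N) = fact N"
  by (simp add: perms_def card_permutations)

lemma card_div_eq_le:
  assumes d: "d > 0"
  shows "card {p \<in> S. p div d = (q::nat)} \<le> d"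
proof -
  have "{p \<in> S. p div d = q} \<subseteq> {q * d..<q * d + d}"
  proof
    fix p assume "p \<in> {p \<in> S. p div d = q}"
    then show "p \<in> {q * d..<q * d + d}"
      using div_mult_mod_eq[of p d] mod_less_divisor[OF d, of p] by auto
  qed
  then have "card {p \<in> S. p div d = q} \<le> card {q * d..<q * d + d}"
    by (intro card_mono) auto
  then show ?thesis by simp
qed

text \<open>
  In a uniformly random permutation of \<open>{..<N}\<close>, two given elements land in the same block of length
  \<open>d\<close> with probability at most \<open>d / N\<close>. The proof even yields \<open>(d - 1) / (N - 1)\<close>: the collision
  probability does not depend on the partner \<open>l\<close> of \<open>i\<close>, and \<open>i\<close> always has at most \<open>d - 1\<close> partners.
\<close>

lemma card_collisions_le:
  assumes "0 < d" "d \<le> N" "i < N" "l < N" "l \<noteq> i"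
  shows "real N * real (card {\<pi> \<in> perms N. \<pi> l div d = \<pi> i div d}) \<le> real d * fact N"
proof -
  define C where "C l = {\<pi> \<in> perms N. \<pi> l div d = \<pi> i div d}" for l
  define R where "R \<pi> = {l \<in> {..<N} - {i}. \<pi> l div d = \<pi> i div d}" for \<pi> :: "nat \<Rightarrow> nat"
  \<comment> \<open>Composition with the transposition of two partners of \<open>i\<close> exchanges their collisions.\<close>
  have C_eq: "card (C l') = card (C l)" if "l' < N" "l' \<noteq> i" for l'
  proof (rule bij_betw_same_card)
    let ?t = "Transposition.transpose l l'"
    have t: "?t permutes {..<N}"
      using that assms by (intro permutes_swap_id) auto
    have ti: "?t i = i"
      using that assms by simp
    show "bij_betw (\<lambda>\<pi>. \<pi> \<circ> ?t) (C l') (C l)"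
      by (rule bij_betwI[where g = "\<lambda>\<pi>. \<pi> \<circ> ?t"])
        (use ti that assms in \<open>auto simp: C_def perms_def comp_assoc intro: permutes_compose[OF t]\<close>)
  qed
  have R_le: "card (R \<pi>) \<le> d - 1" if \<pi>: "\<pi> \<in> perms N" for \<pi>
  proof -
    have inj: "inj \<pi>"
      using \<pi> by (simp add: perms_def permutes_inj)
    have "card (insert i (R \<pi>)) = card (\<pi> ` insert i (R \<pi>))"
      by (rule card_image[symmetric], rule inj_on_subset[OF inj]) simp
    also have "\<dots> \<le> card {p \<in> \<pi> ` insert i (R \<pi>). p div d = \<pi> i div d}"
      by (rule card_mono) (auto simp: R_def)
    also have "\<dots> \<le> d"
      by (rule card_div_eq_le[OF assms(1)])
    finally show ?thesis
      by (simp add: R_def)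
  qed
  \<comment> \<open>Count the pairs of a permutation and a partner of \<open>i\<close> in two ways.\<close>
  have "(N - 1) * card (C l) = (\<Sum>l'\<in>{..<N} - {i}. card (C l))"
    using assms by simp
  also have "\<dots> = (\<Sum>l'\<in>{..<N} - {i}. card (C l'))"
    by (rule sum.cong[OF refl], rule C_eq[symmetric]) auto
  also have "\<dots> = (\<Sum>l'\<in>{..<N} - {i}. \<Sum>\<pi>\<in>perms N. if \<pi> l' div d = \<pi> i div d then 1 else 0)"
    by (simp only: C_def card_eq_sum sum.inter_filter[OF finite_perms])
  also have "\<dots> = (\<Sum>\<pi>\<in>perms N. card (R \<pi>))"
    by (subst sum.swap) (simp only: R_def card_eq_sum sum.inter_filter[OF finite_Diff[OF finite_lessThan]])
  also have "\<dots> \<le> (\<Sum>\<pi>\<in>perms N. d - 1)"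
    by (intro sum_mono R_le)
  finally have "(N - 1) * card (C l) \<le> fact N * (d - 1)"
    by simp
  then have "real (N - 1) * real (card (C l)) \<le> fact N * real (d - 1)"
    by (metis of_nat_fact of_nat_le_iff of_nat_mult)
  then have 1: "(real N - 1) * real (card (C l)) \<le> (real d - 1) * fact N"
    using assms by (simp add: of_nat_diff mult.commute)
  have "card (C l) \<le> fact N"
    using card_mono[of "perms N" "C l"] by (auto simp: C_def)
  then have "real (card (C l)) \<le> fact N"
    by (metis of_nat_fact of_nat_le_iff)
  with 1 show ?thesis
    unfolding C_def[symmetric] by (simp add: algebra_simps)
qed

section \<open>Adaptive search inside a bucket\<close>

text \<open>
  A bucket is split into \<open>2 ^ depth j\<close> cells of level \<open>j\<close>, each consisting of \<open>width J j\<close> consecutive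
  positions; the cells of level \<open>J\<close> are single positions. A position \<open>p\<close> belongs to the cell with
  number \<open>p div width J j\<close> (counted through all buckets), so a bucket is a cell of level 0. A cell of
  level \<open>j\<close> has \<open>2 ^ (1 + 2 ^ j)\<close> subcells.
\<close>

definition depth :: "nat \<Rightarrow> nat" where
  "depth j = j + (2 ^ j - 1)"

definition width :: "nat \<Rightarrow> nat \<Rightarrow> nat" where
  "width J j = 2 ^ (depth J - depth j)"

lemma depth_Suc: "depth (Suc j) = depth j + (1 + 2 ^ j)"
proof -
  have "(2::nat) ^ j \<ge> 1"
    by simp
  then show ?thesis
    unfolding depth_def by simp
qed

lemma depth_mono: "i \<le> j \<Longrightarrow> depth i \<le> depth j"
  by (rule lift_Suc_mono_le[of depth]) (auto simp: depth_Suc)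

lemma width_pos [simp]: "width J j > 0"
  by (simp add: width_def)

lemma width_last [simp]: "width J J = 1"
  by (simp add: width_def)

lemma width_step:
  assumes "j < J"
  shows "width J j = width J (Suc j) * 2 ^ (1 + 2 ^ j)"
proof -
  have "depth J - depth j = (depth J - depth (Suc j)) + (1 + 2 ^ j)"
    using depth_mono[of "Suc j" J] assms by (simp add: depth_Suc)
  then show ?thesis
    unfolding width_def by (simp only: power_add)
qed

lemma width_0: "j \<le> J \<Longrightarrow> width J 0 = width J j * 2 ^ depth j"
  using depth_mono[of j J] by (simp add: width_def depth_def[of 0] flip: power_add)

text \<open>
  The search step. If \<open>x i\<close> dominates the coordinates in \<open>C\<close>, then the ratio of the two measurements
  differs from \<open>h i\<close> by less than 1/2: the difference is a fraction whose numerator is the sum of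
  \<open>(h l - h i) * x l\<close>, to which \<open>l = i\<close> contributes nothing, and whose denominator has absolute value at
  least \<open>\<bar>x i\<bar> / 2\<close>.
\<close>

lemma round_ratio:
  fixes x :: "'a \<Rightarrow> real" and h :: "'a \<Rightarrow> nat"
  assumes "finite C" "i \<in> C" "1 \<le> B"
    and close: "\<And>l. l \<in> C \<Longrightarrow> \<bar>real (h l) - real (h i)\<bar> \<le> B - 1"
    and small: "2 * B * (\<Sum>l\<in>C - {i}. \<bar>x l\<bar>) < \<bar>x i\<bar>"
  shows "nat (round ((\<Sum>l\<in>C. real (h l) * x l) / (\<Sum>l\<in>C. x l))) = h i"
proof -
  define u where "u = (\<Sum>l\<in>C. x l)"
  define v where "v = (\<Sum>l\<in>C. real (h l) * x l)"
  define w where "w = (\<Sum>l\<in>C - {i}. \<bar>x l\<bar>)"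
  have w0: "w \<ge> 0"
    by (simp add: w_def sum_nonneg)
  have "u = x i + (\<Sum>l\<in>C - {i}. x l)"
    using assms by (simp add: u_def sum.remove)
  moreover have "\<bar>\<Sum>l\<in>C - {i}. x l\<bar> \<le> w"
    unfolding w_def by (rule sum_abs)
  ultimately have u: "\<bar>u\<bar> \<ge> \<bar>x i\<bar> - w"
    by linarith
  have "v - real (h i) * u = (\<Sum>l\<in>C. (real (h l) - real (h i)) * x l)"
    by (simp add: u_def v_def sum_distrib_left sum_subtractf left_diff_distrib)
  also have "\<dots> = (\<Sum>l\<in>C - {i}. (real (h l) - real (h i)) * x l)"
    using assms by (simp add: sum.remove)
  also have "\<bar>\<dots>\<bar> \<le> (\<Sum>l\<in>C - {i}. \<bar>(real (h l) - real (h i)) * x l\<bar>)"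
    by (rule sum_abs)
  also have "\<dots> \<le> (\<Sum>l\<in>C - {i}. (B - 1) * \<bar>x l\<bar>)"
    by (intro sum_mono) (auto simp: abs_mult intro!: mult_right_mono close)
  also have "\<dots> = (B - 1) * w"
    by (simp add: w_def sum_distrib_left)
  finally have v: "\<bar>v - real (h i) * u\<bar> \<le> (B - 1) * w" .
  have "w \<le> B * w"
    using w0 assms(3) by (simp add: mult_le_cancel_right1)
  then have "u \<noteq> 0" "\<bar>v - real (h i) * u\<bar> < \<bar>u\<bar> / 2"
    using u v small w0 unfolding w_def[symmetric] by (auto simp: algebra_simps)
  then have "\<bar>v / u - of_int (int (h i))\<bar> < 1 / 2"
    by (simp add: divide_simps abs_if split: if_splits)
  then have "round (v / u) = int (h i)"
    by (rule round_unique')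
  then show ?thesis
    by (simp add: u_def v_def)
qed

text \<open>
  The number of the cell of level \<open>j\<close> to which the search in bucket \<open>b\<close> has narrowed down, given the
  observed values \<open>y\<close>. The values with indices \<open>b * (2 * J + 1) + s\<close>, \<open>s \<le> 2 * J\<close>, belong to bucket \<open>b\<close>;
  those with \<open>s = 2 * j\<close> and \<open>s = 2 * j + 1\<close> are the plain and the weighted sum over the cell of level
  \<open>j\<close>. Outside the situation of \<open>round_ratio\<close> the resulting number is arbitrary and harmless.
\<close>

definition cell :: "nat \<Rightarrow> (nat \<Rightarrow> real) \<Rightarrow> nat \<Rightarrow> nat \<Rightarrow> nat" where
  "cell J y b j = (if j = 0 then b
     else nat (round (y (b * (2 * J + 1) + 2 * j - 1) / y (b * (2 * J + 1) + 2 * j - 2))))"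

text \<open>
  The position of coordinate \<open>i\<close>. Sample points are real sequences that encode a permutation.
\<close>

definition pos :: "(nat \<Rightarrow> real) \<Rightarrow> nat \<Rightarrow> nat" where
  "pos \<omega> i = nat \<lfloor>\<omega> i\<rfloor>"

text \<open>
  The coefficient of a coordinate at position \<open>p\<close> in the measurement with index \<open>s\<close> in a bucket,
  where \<open>c\<close> is the current cell.
\<close>

definition weight :: "nat \<Rightarrow> nat \<Rightarrow> nat \<Rightarrow> nat \<Rightarrow> real" where
  "weight J s c p = (if p div width J (s div 2) \<noteq> c then 0
     else if even s then 1 else real (p div width J (Suc (s div 2))))"

text \<open>
  The \<open>k\<close>-th functional of the algorithm. It is defined for all \<open>k\<close>; if the number of measurements is
  not a multiple of \<open>2 * J + 1\<close>, the last ones belong to a bucket that is not searched completely.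
\<close>

definition measurement ::
  "nat \<Rightarrow> nat \<Rightarrow> nat \<Rightarrow> (nat \<Rightarrow> real) \<times> (nat \<Rightarrow> real) \<Rightarrow> (nat \<Rightarrow>\<^sub>0 real) \<Rightarrow> real" where
  "measurement m J k = (\<lambda>(\<omega>, y).
     let b = k div (2 * J + 1); s = k mod (2 * J + 1); c = cell J y b (s div 2)
     in weighted_sum m (\<lambda>i. weight J s c (pos \<omega> i)))"

text \<open>
  The output at coordinate \<open>i\<close> for the positions \<open>p\<close> and the observed values \<open>y\<close>: the last value from the
  bucket of \<open>i\<close> if the search in this bucket was completed and ended at the position of \<open>i\<close>, and 0
  otherwise.
\<close>

definition recovered :: "nat \<Rightarrow> nat \<Rightarrow> (nat \<Rightarrow> nat) \<Rightarrow> (nat \<Rightarrow> real) \<Rightarrow> nat \<Rightarrow> real" where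
  "recovered n J p y i =
     (let b = p i div width J 0; k = b * (2 * J + 1) + 2 * J
      in if k < n \<and> cell J y b J = p i then y k else 0)"

definition reconstruction ::
  "nat \<Rightarrow> nat \<Rightarrow> nat \<Rightarrow> (nat \<Rightarrow> real) \<times> (nat \<Rightarrow> real) \<Rightarrow> (nat \<Rightarrow>\<^sub>0 real)" where
  "reconstruction m n J = (\<lambda>(\<omega>, y). fin_vec m (recovered n J (pos \<omega>) y))"

text \<open>
  The uniform distribution on the permutations of \<open>N\<close> positions, each one encoded as a real sequence.
\<close>

definition sample :: "nat \<Rightarrow> (nat \<Rightarrow> real) measure" where
  "sample N = uniform_count_measure ((\<lambda>\<pi> i. real (\<pi> i)) ` perms N)"

lemma measurable_cell:
  assumes "j > 0 \<Longrightarrow> b * (2 * J + 1) + 2 * j \<le> k"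
  shows "(\<lambda>y. cell J y b j) \<in> measurable (borel_Rn k) (count_space UNIV)"
proof (cases "j = 0")
  case False
  then have [measurable]:
    "(\<lambda>y. y (b * (2 * J + 1) + 2 * j - 1)) \<in> borel_measurable (borel_Rn k)"
    "(\<lambda>y. y (b * (2 * J + 1) + 2 * j - 2)) \<in> borel_measurable (borel_Rn k)"
    using assms by (auto intro!: measurable_component_singleton)
  show ?thesis
    using False unfolding cell_def round_def if_not_P[OF False] by measurable
qed (simp add: cell_def)

text \<open>
  The sample space is finite and discrete, so only measurability in the second argument matters.
\<close>

lemma measurable_sample_pair:
  assumes "\<And>\<omega>. (\<lambda>y. g (\<omega>, y)) \<in> measurable L K"
  shows "g \<in> measurable (sample N \<Otimes>\<^sub>M L) K"
proof -
  let ?A = "(\<lambda>\<pi> i. real (\<pi> i)) ` perms N"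
  have "g \<in> measurable (count_space ?A \<Otimes>\<^sub>M L) K"
    by (rule measurable_pair_measure_countable1) (use assms in \<open>auto intro: countable_finite\<close>)
  moreover have "sets (sample N \<Otimes>\<^sub>M L) = sets (count_space ?A \<Otimes>\<^sub>M L)"
    by (intro sets_pair_measure_cong) (simp_all add: sample_def sets_uniform_count_measure)
  ultimately show ?thesis
    using measurable_cong_sets by blast
qed

lemma rand_algorithm_search:
  "rand_algorithm n (lp 1 m) (lp 2 m) (sample N) (measurement m J) (reconstruction m n J)"
  unfolding rand_algorithm_def
proof (intro conjI allI impI)
  have "perms N \<noteq> {}"
    using permutes_id[of "{..<N}"] unfolding perms_def by blast
  then show "prob_space (sample N)"
    unfolding sample_def by (intro prob_space_uniform_count_measure) auto
  show "complete_measure (sample N)"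
    by standard (auto simp: sample_def sets_uniform_count_measure null_sets_def)
  show "measurement m J k \<in> measurable (sample N \<Otimes>\<^sub>M borel_Rn k) (borel_nspace (dual_nspace (lp 1 m)))"
    for k
  proof (rule measurable_sample_pair)
    fix \<omega>
    define b s where "b = k div (2 * J + 1)" and "s = k mod (2 * J + 1)"
    have "b * (2 * J + 1) + s = k"
      unfolding b_def s_def by (rule div_mult_mod_eq)
    then have "(\<lambda>y. cell J y b (s div 2)) \<in> measurable (borel_Rn k) (count_space UNIV)"
      by (intro measurable_cell) linarith
    moreover have "(\<lambda>c. weighted_sum m (\<lambda>i. weight J s c (pos \<omega> i)))
        \<in> measurable (count_space UNIV) (borel_nspace (dual_nspace (lp 1 m)))"
      by (simp add: space_borel_nspace weighted_sum_in_dual)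
    ultimately have "(\<lambda>y. weighted_sum m (\<lambda>i. weight J s (cell J y b (s div 2)) (pos \<omega> i)))
        \<in> measurable (borel_Rn k) (borel_nspace (dual_nspace (lp 1 m)))"
      by (rule measurable_compose)
    then show "(\<lambda>y. measurement m J k (\<omega>, y))
        \<in> measurable (borel_Rn k) (borel_nspace (dual_nspace (lp 1 m)))"
      by (simp add: measurement_def b_def s_def Let_def)
  qed
  show "reconstruction m n J \<in> measurable (sample N \<Otimes>\<^sub>M borel_Rn n) (borel_nspace (lp 2 m))"
  proof (rule measurable_sample_pair)
    fix \<omega>
    have "(\<lambda>y. recovered n J (pos \<omega>) y i) \<in> borel_measurable (borel_Rn n)" for i
    proof -
      define b where "b = pos \<omega> i div width J 0"
      define k where "k = b * (2 * J + 1) + 2 * J"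
      show ?thesis
      proof (cases "k < n")
        case True
        then have [measurable]: "(\<lambda>y. y k) \<in> borel_measurable (borel_Rn n)"
          by (intro measurable_component_singleton) simp
        have [measurable]: "(\<lambda>y. cell J y b J) \<in> measurable (borel_Rn n) (count_space UNIV)"
          using True by (intro measurable_cell) (simp add: k_def)
        show ?thesis
          using True unfolding recovered_def Let_def b_def[symmetric] k_def[symmetric] by measurable
      next
        case False
        then show ?thesis
          unfolding recovered_def Let_def b_def[symmetric] k_def[symmetric] by simp
      qed
    qed
    then show "(\<lambda>y. reconstruction m n J (\<omega>, y)) \<in> measurable (borel_Rn n) (borel_nspace (lp 2 m))"
      by (simp add: reconstruction_def measurable_fin_vec)
  qed
qed

text \<open>
  The values observed for the input \<open>f\<close> when the permutation \<open>\<pi>\<close> was drawn.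
\<close>

definition answers :: "nat \<Rightarrow> nat \<Rightarrow> nat \<Rightarrow> (nat \<Rightarrow> nat) \<Rightarrow> (nat \<Rightarrow>\<^sub>0 real) \<Rightarrow> nat \<Rightarrow> real" where
  "answers m n J \<pi> f = information (measurement m J) (\<lambda>i. real (\<pi> i)) f n"

lemma pos_real [simp]: "pos (\<lambda>i. real (\<pi> i)) = \<pi>"
  by (simp add: pos_def fun_eq_iff)

lemma information_eq: "k < n \<Longrightarrow> information l \<omega> f n k = l k (\<omega>, information l \<omega> f k) f"
  by (induction n) (auto simp: less_Suc_eq)

lemma answers_eq:
  assumes "f \<in> vecs (lp 1 m)" "s < 2 * J + 1" "b * (2 * J + 1) + s < n"
  shows "answers m n J \<pi> f (b * (2 * J + 1) + s) =
    (\<Sum>l<m. weight J s (cell J (answers m n J \<pi> f) b (s div 2)) (\<pi> l) * Poly_Mapping.lookup f l)"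
proof -
  define k where "k = b * (2 * J + 1) + s"
  define y where "y = information (measurement m J) (\<lambda>i. real (\<pi> i)) f k"
  have k: "k div (2 * J + 1) = b" "k mod (2 * J + 1) = s" "k < n"
    using assms div_mult_self3[of "2 * J + 1" b s] mod_mult_self3[of b "2 * J + 1" s]
    by (simp_all only: k_def div_less mod_less add_0_right)
  have same: "y i = answers m n J \<pi> f i" if "i < k" for i
    using that k(3) by (simp add: y_def answers_def information_eq)
  have "b * (2 * J + 1) + 2 * (s div 2) \<le> k"
    by (simp add: k_def)
  then have "cell J y b (s div 2) = cell J (answers m n J \<pi> f) b (s div 2)"
    unfolding cell_def by (auto intro!: arg_cong2[where f = divide] arg_cong[where f = round]
      arg_cong[where f = nat] same)
  moreover have "answers m n J \<pi> f k = measurement m J k (\<lambda>i. real (\<pi> i), y) f"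
    unfolding answers_def y_def using k(3) by (rule information_eq)
  ultimately show ?thesis
    using assms(1) k unfolding k_def[symmetric] by (simp add: measurement_def Let_def weighted_sum_def)
qed

text \<open>
  The sum of the absolute values of all other coordinates in the cell of width \<open>d\<close> that contains \<open>i\<close>.
\<close>

definition noise :: "nat \<Rightarrow> (nat \<Rightarrow> nat) \<Rightarrow> (nat \<Rightarrow>\<^sub>0 real) \<Rightarrow> nat \<Rightarrow> nat \<Rightarrow> real" where
  "noise m \<pi> f d i =
     (\<Sum>l\<in>{l \<in> {..<m}. \<pi> l div d = \<pi> i div d} - {i}. \<bar>Poly_Mapping.lookup f l\<bar>)"

text \<open>
  At some level, the noise around coordinate \<open>i\<close> is too large for \<open>round_ratio\<close> to apply. Otherwise the
  search in the bucket of \<open>i\<close>, if completed, ends at the position of \<open>i\<close>.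
\<close>

definition lost :: "nat \<Rightarrow> nat \<Rightarrow> (nat \<Rightarrow> nat) \<Rightarrow> (nat \<Rightarrow>\<^sub>0 real) \<Rightarrow> nat \<Rightarrow> bool" where
  "lost m J \<pi> f i \<longleftrightarrow>
     (\<exists>j<J. \<bar>Poly_Mapping.lookup f i\<bar> \<le> 2 * 2 ^ (1 + 2 ^ j) * noise m \<pi> f (width J j) i)"

lemma cell_located:
  assumes "f \<in> vecs (lp 1 m)" "i < m" "\<not> lost m J \<pi> f i"
    and b: "b = \<pi> i div width J 0" "b * (2 * J + 1) + 2 * J < n"
    and "j \<le> J"
  shows "cell J (answers m n J \<pi> f) b j = \<pi> i div width J j"
  using \<open>j \<le> J\<close>
proof (induction j)
  case 0
  then show ?case
    by (simp add: cell_def b)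
next
  case (Suc j)
  define y where "y = answers m n J \<pi> f"
  define C where "C = {l \<in> {..<m}. \<pi> l div width J j = \<pi> i div width J j}"
  define h where "h l = \<pi> l div width J (Suc j)" for l
  define x where "x = Poly_Mapping.lookup f"
  define B where "B = (2::nat) ^ (1 + 2 ^ j)"
  have j: "j < J"
    using Suc by simp
  have IH: "cell J y b j = \<pi> i div width J j"
    using Suc by (simp add: y_def)
  have u: "y (b * (2 * J + 1) + 2 * j) = (\<Sum>l\<in>C. x l)"
  proof -
    have "y (b * (2 * J + 1) + 2 * j) =
        (\<Sum>l<m. weight J (2 * j) (cell J y b j) (\<pi> l) * x l)"
      using answers_eq[of f m "2 * j" J b n \<pi>] assms(1) b(2) j by (simp add: y_def x_def)
    also have "\<dots> = (\<Sum>l<m. if \<pi> l div width J j = \<pi> i div width J j then x l else 0)"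
      by (rule sum.cong) (auto simp: weight_def IH)
    finally show ?thesis
      unfolding C_def by (simp only: sum.inter_filter[OF finite_lessThan])
  qed
  have v: "y (b * (2 * J + 1) + (2 * j + 1)) = (\<Sum>l\<in>C. real (h l) * x l)"
  proof -
    have "y (b * (2 * J + 1) + (2 * j + 1)) =
        (\<Sum>l<m. weight J (2 * j + 1) (cell J y b j) (\<pi> l) * x l)"
      using answers_eq[of f m "2 * j + 1" J b n \<pi>] assms(1) b(2) j by (simp add: y_def x_def)
    also have "\<dots> = (\<Sum>l<m. if \<pi> l div width J j = \<pi> i div width J j then real (h l) * x l else 0)"
      by (rule sum.cong) (auto simp: weight_def IH h_def)
    finally show ?thesis
      unfolding C_def by (simp only: sum.inter_filter[OF finite_lessThan])
  qed
  have "nat (round ((\<Sum>l\<in>C. real (h l) * x l) / (\<Sum>l\<in>C. x l))) = h i"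
  proof (rule round_ratio)
    have "1 \<le> B"
      unfolding B_def by (rule one_le_power) simp
    then show "1 \<le> real B"
      by simp
    show "finite C" "i \<in> C"
      using assms(2) by (auto simp: C_def)
    show "\<bar>real (h l) - real (h i)\<bar> \<le> real B - 1" if "l \<in> C" for l
    proof -
      have "h l div B = h i div B"
        using that width_step[OF j] by (simp add: C_def h_def B_def div_mult2_eq)
      then have "h l = h i div B * B + h l mod B"
        by (metis div_mult_mod_eq)
      moreover have "h i = h i div B * B + h i mod B"
        by simp
      moreover have "h l mod B < B" "h i mod B < B"
        by (simp_all add: B_def)
      ultimately have "h l + 1 \<le> h i + B" "h i + 1 \<le> h l + B"
        by linarith+
      then have "real (h l + 1) \<le> real (h i + B)" "real (h i + 1) \<le> real (h l + B)"
        by (simp_all only: of_nat_le_iff)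
      then show ?thesis
        by simp
    qed
    show "2 * real B * (\<Sum>l\<in>C - {i}. \<bar>x l\<bar>) < \<bar>x i\<bar>"
      using assms(3) j by (auto simp: lost_def noise_def C_def x_def B_def not_le)
  qed
  then show ?case
    unfolding cell_def using u v by (simp add: h_def flip: y_def)
qed

text \<open>
  Every output coordinate is exact or 0. It is exact if it is not lost and if the \<open>n\<close> measurements
  include all those of its bucket.
\<close>

lemma recovered_eq:
  assumes "f \<in> vecs (lp 1 m)" "i < m" "inj \<pi>"
  shows "recovered n J \<pi> (answers m n J \<pi> f) i \<in> {0, Poly_Mapping.lookup f i}"
    and "\<not> lost m J \<pi> f i \<Longrightarrow> \<pi> i div width J 0 * (2 * J + 1) + 2 * J < n \<Longrightarrow>
      recovered n J \<pi> (answers m n J \<pi> f) i = Poly_Mapping.lookup f i"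
proof -
  define y where "y = answers m n J \<pi> f"
  define b where "b = \<pi> i div width J 0"
  have val: "y (b * (2 * J + 1) + 2 * J) = Poly_Mapping.lookup f i"
    if "b * (2 * J + 1) + 2 * J < n" "cell J y b J = \<pi> i"
  proof -
    have "y (b * (2 * J + 1) + 2 * J) =
        (\<Sum>l<m. weight J (2 * J) (\<pi> i) (\<pi> l) * Poly_Mapping.lookup f l)"
      using answers_eq[of f m "2 * J" J b n \<pi>] assms(1) that by (simp add: y_def)
    also have "\<dots> = (\<Sum>l<m. if l = i then Poly_Mapping.lookup f l else 0)"
      using assms(3) by (intro sum.cong) (auto simp: weight_def inj_eq)
    finally show ?thesis
      using assms(2) by simp
  qed
  then show "recovered n J \<pi> (answers m n J \<pi> f) i \<in> {0, Poly_Mapping.lookup f i}"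
    by (auto simp: recovered_def Let_def b_def y_def)
  show "recovered n J \<pi> (answers m n J \<pi> f) i = Poly_Mapping.lookup f i"
    if "\<not> lost m J \<pi> f i" "\<pi> i div width J 0 * (2 * J + 1) + 2 * J < n"
  proof -
    have "cell J y b J = \<pi> i"
      using cell_located[OF assms(1,2) that(1) b_def, of n J] that(2) by (simp add: b_def y_def)
    then show ?thesis
      using val that(2) by (simp add: recovered_def Let_def b_def y_def)
  qed
qed

section \<open>The expected error\<close>

lemma sum_noise_le:
  assumes "(\<Sum>l<m. \<bar>Poly_Mapping.lookup f l\<bar>) \<le> 1" "i < m" "m \<le> N" "0 < d" "d \<le> N"
  shows "real N * (\<Sum>\<pi>\<in>perms N. noise m \<pi> f d i) \<le> real d * fact N"
proof -
  define x where "x l = \<bar>Poly_Mapping.lookup f l\<bar>" for l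
  define c where "c l = real (card {\<pi> \<in> perms N. \<pi> l div d = \<pi> i div d})" for l
  have noise: "noise m \<pi> f d i = (\<Sum>l\<in>{..<m} - {i}. if \<pi> l div d = \<pi> i div d then x l else 0)" for \<pi>
  proof -
    have "{l \<in> {..<m}. \<pi> l div d = \<pi> i div d} - {i} = {l \<in> {..<m} - {i}. \<pi> l div d = \<pi> i div d}"
      by auto
    then show ?thesis
      unfolding noise_def x_def by (simp only: sum.inter_filter[OF finite_Diff[OF finite_lessThan]])
  qed
  have "(\<Sum>\<pi>\<in>perms N. noise m \<pi> f d i) =
      (\<Sum>l\<in>{..<m} - {i}. \<Sum>\<pi>\<in>perms N. if \<pi> l div d = \<pi> i div d then x l else 0)"
    unfolding noise by (rule sum.swap)
  also have "\<dots> = (\<Sum>l\<in>{..<m} - {i}. c l * x l)"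
    unfolding c_def by (simp only: sum.inter_filter[OF finite_perms, symmetric] sum_constant)
  finally have "real N * (\<Sum>\<pi>\<in>perms N. noise m \<pi> f d i) = (\<Sum>l\<in>{..<m} - {i}. real N * c l * x l)"
    by (simp add: sum_distrib_left mult.assoc)
  also have "\<dots> \<le> (\<Sum>l\<in>{..<m} - {i}. real d * fact N * x l)"
    unfolding c_def using assms
    by (intro sum_mono mult_right_mono card_collisions_le) (auto simp: x_def)
  also have "\<dots> = real d * fact N * (\<Sum>l\<in>{..<m} - {i}. x l)"
    by (simp add: sum_distrib_left)
  also have "\<dots> \<le> real d * fact N * 1"
  proof (rule mult_left_mono)
    have "(\<Sum>l\<in>{..<m} - {i}. x l) \<le> (\<Sum>l<m. x l)"
      by (rule sum_mono2) (auto simp: x_def)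
    then show "(\<Sum>l\<in>{..<m} - {i}. x l) \<le> 1"
      using assms(1) by (simp add: x_def)
  qed simp
  finally show ?thesis
    by simp
qed

text \<open>
  For \<open>\<parallel>f\<parallel>\<^sub>1 \<le> 1\<close>, coordinate \<open>i\<close> is lost with probability at most \<open>16 / (k * \<bar>f i\<bar>)\<close>. The factor \<open>\<bar>f i\<bar>\<close> on the left
  covers the case of a zero coordinate.
\<close>

lemma card_lost_le:
  assumes "(\<Sum>l<m. \<bar>Poly_Mapping.lookup f l\<bar>) \<le> 1" "i < m" "k > 0"
    and N: "N = k * width J 0" "m \<le> N"
  shows "\<bar>Poly_Mapping.lookup f i\<bar> * real (card {\<pi> \<in> perms N. lost m J \<pi> f i}) \<le> 16 / k * fact N"
proof -
  define a where "a = \<bar>Poly_Mapping.lookup f i\<bar>"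
  define g where "g j \<pi> = 2 * 2 ^ (1 + 2 ^ j) * noise m \<pi> f (width J j) i" for j \<pi>
  have g0: "g j \<pi> \<ge> 0" for j \<pi>
    by (simp add: g_def noise_def sum_nonneg)
  have "a * real (card {\<pi> \<in> perms N. lost m J \<pi> f i}) =
      (\<Sum>\<pi>\<in>perms N. if lost m J \<pi> f i then a else 0)"
    by (simp only: sum.inter_filter[OF finite_perms, symmetric] sum_constant mult.commute)
  \<comment> \<open>Markov's inequality and the union bound over the levels.\<close>
  also have "\<dots> \<le> (\<Sum>\<pi>\<in>perms N. \<Sum>j<J. g j \<pi>)"
  proof (rule sum_mono)
    fix \<pi>
    have "a \<le> (\<Sum>j<J. g j \<pi>)" if lost: "lost m J \<pi> f i"
    proof -
      obtain j where "j < J" "a \<le> g j \<pi>"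
        using lost unfolding lost_def a_def g_def by blast
      moreover have "g j \<pi> \<le> (\<Sum>j<J. g j \<pi>)"
        using \<open>j < J\<close> g0 by (intro member_le_sum) auto
      ultimately show ?thesis
        by linarith
    qed
    then show "(if lost m J \<pi> f i then a else 0) \<le> (\<Sum>j<J. g j \<pi>)"
      by (simp add: sum_nonneg g0)
  qed
  also have "\<dots> = (\<Sum>j<J. \<Sum>\<pi>\<in>perms N. g j \<pi>)"
    by (rule sum.swap)
  also have "\<dots> \<le> (\<Sum>j<J. 8 / k * (1 / 2) ^ j * fact N)"
  proof (rule sum_mono)
    fix j assume "j \<in> {..<J}"
    then have j: "j \<le> J"
      by simp
    define d where "d = width J j"
    define W where "W = (\<Sum>\<pi>\<in>perms N. noise m \<pi> f d i)"
    have d: "d > 0"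
      by (simp add: d_def)
    have Nd: "N = k * d * 2 ^ depth j"
      using width_0[OF j] by (simp add: N(1) d_def)
    have "d * 1 \<le> d * (k * 2 ^ depth j)"
      using \<open>k > 0\<close> by (intro mult_left_mono) auto
    then have "d \<le> N"
      by (simp add: Nd mult_ac)
    then have "real N * W \<le> real d * fact N"
      unfolding W_def using assms d by (intro sum_noise_le) auto
    then have "real d * (real k * 2 ^ depth j * W) \<le> real d * fact N"
      by (simp add: Nd mult_ac)
    then have W: "real k * 2 ^ depth j * W \<le> fact N"
      using d by simp
    have "(\<Sum>\<pi>\<in>perms N. g j \<pi>) = 2 * 2 ^ (1 + 2 ^ j) * W"
      by (simp add: g_def W_def d_def sum_distrib_left)
    moreover have "(2::real) ^ depth j * 2 = 2 ^ j * 2 ^ 2 ^ j"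
    proof -
      have "Suc (depth j) = j + 2 ^ j"
        by (simp add: depth_def)
      then show ?thesis
        by (metis power_Suc2 power_add)
    qed
    ultimately have "(\<Sum>\<pi>\<in>perms N. g j \<pi>) * 2 ^ j = 8 * (2 ^ depth j * W)"
      by (simp add: mult_ac)
    with W show "(\<Sum>\<pi>\<in>perms N. g j \<pi>) \<le> 8 / k * (1 / 2) ^ j * fact N"
      using \<open>k > 0\<close> by (simp add: field_simps power_one_over)
  qed
  also have "\<dots> = 8 / k * fact N * (\<Sum>j<J. (1 / 2) ^ j)"
    by (subst sum_distrib_left) (simp add: mult_ac)
  also have "\<dots> \<le> 8 / k * fact N * 2"
  proof (rule mult_left_mono)
    have "(\<Sum>j<J. (1 / 2) ^ j) = 2 - 2 * (1 / 2 :: real) ^ J"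
      by (induction J) (auto simp: field_simps)
    then show "(\<Sum>j<J. (1 / 2 :: real) ^ j) \<le> 2"
      by simp
  qed simp
  finally show ?thesis
    by (simp add: a_def)
qed

text \<open>
  The error in the \<open>\<ell>\<^sub>2\<close> norm for the input \<open>f\<close> when the permutation \<open>\<pi>\<close> was drawn.
\<close>

definition error :: "nat \<Rightarrow> nat \<Rightarrow> nat \<Rightarrow> (nat \<Rightarrow>\<^sub>0 real) \<Rightarrow> (nat \<Rightarrow> nat) \<Rightarrow> real" where
  "error m n J f \<pi> = sqrt (\<Sum>i<m.
     (recovered n J \<pi> (answers m n J \<pi> f) i - Poly_Mapping.lookup f i)\<^sup>2)"

text \<open>
  A bound \<open>C\<close> for the mean error over all permutations of \<open>N\<close> positions bounds the minimal error. Here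
  \<open>N\<close> and \<open>J\<close> are arbitrary and need not fit to \<open>n\<close> and \<open>m\<close>.
\<close>

lemma e_ran_id_le_average:
  assumes "\<And>f. f \<in> vecs (lp 1 m) \<Longrightarrow> (\<Sum>i<m. \<bar>Poly_Mapping.lookup f i\<bar>) \<le> 1 \<Longrightarrow>
      (\<Sum>\<pi>\<in>perms N. error m n J f \<pi>) \<le> C * fact N"
  shows "e_ran_id n 1 2 m \<le> ennreal C"
proof -
  let ?A = "alg_output n (measurement m J) (reconstruction m n J)"
  let ?r = "\<lambda>\<pi> i. real (\<pi> i)"
  have "e_ran_id n 1 2 m \<le> alg_error (lp 1 m) (lp 2 m) (\<lambda>x. x) (sample N) ?A"
    unfolding e_ran_id_def e_ran_def by (rule Inf_lower) (use rand_algorithm_search in blast)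
  also have "\<dots> \<le> ennreal C"
    unfolding alg_error_def
  proof (rule SUP_least)
    fix f assume "f \<in> {f \<in> vecs (lp 1 m). vnorm (lp 1 m) f \<le> 1}"
    then have f: "f \<in> vecs (lp 1 m)" "(\<Sum>i<m. \<bar>Poly_Mapping.lookup f i\<bar>) \<le> 1"
      by (auto simp: vnorm_lp_1)
    have inj: "inj_on ?r (perms N)"
      by (auto simp: inj_on_def fun_eq_iff)
    have out: "vnorm (lp 2 m) (?A (?r \<pi>) f - f) = error m n J f \<pi>" for \<pi>
      by (simp add: vnorm_lp_2 alg_output_def reconstruction_def lookup_minus error_def answers_def)
    have "(\<integral>\<^sup>+ \<omega>. ennreal (vnorm (lp 2 m) (?A \<omega> f - f)) \<partial>sample N) =
        (\<Sum>\<pi>\<in>perms N. ennreal (1 / fact N) * ennreal (error m n J f \<pi>))"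
      using inj unfolding sample_def uniform_count_measure_def
      by (subst nn_integral_point_measure_finite) (simp_all add: sum.reindex card_image out)
    also have "\<dots> = ennreal ((\<Sum>\<pi>\<in>perms N. error m n J f \<pi>) / fact N)"
      by (simp add: ennreal_mult[symmetric] sum_ennreal sum_divide_distrib error_def sum_nonneg)
    also have "\<dots> \<le> ennreal C"
      using assms[OF f] by (intro ennreal_leI) (simp add: field_simps)
    finally show "(\<integral>\<^sup>+ \<omega>. ennreal (vnorm (lp 2 m) (?A \<omega> f - f)) \<partial>sample N) \<le> ennreal C" .
  qed
  finally show ?thesis .
qed

text \<open>
  No choice of the parameters makes the error exceed the norm of the input, because every output
  coordinate is exact or 0.
\<close>

lemma e_ran_id_le_1: "e_ran_id n 1 2 m \<le> ennreal 1"
proof (rule e_ran_id_le_average[where N = m and J = 0])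
  fix f assume f: "f \<in> vecs (lp 1 m)" "(\<Sum>i<m. \<bar>Poly_Mapping.lookup f i\<bar>) \<le> 1"
  have "error m n 0 f \<pi> \<le> 1" if "\<pi> \<in> perms m" for \<pi>
  proof -
    have "inj \<pi>"
      using that by (simp add: perms_def permutes_inj)
    then have "\<bar>recovered n 0 \<pi> (answers m n 0 \<pi> f) i - Poly_Mapping.lookup f i\<bar> \<le>
        \<bar>Poly_Mapping.lookup f i\<bar>" if "i < m" for i
      using recovered_eq(1)[OF f(1) that, of \<pi> n 0] by auto
    then have "error m n 0 f \<pi> \<le> L2_set (Poly_Mapping.lookup f) {..<m}"
      unfolding error_def L2_set_def
      by (intro real_sqrt_le_mono sum_mono) (auto simp: abs_le_square_iff)
    also have "\<dots> \<le> 1"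
      using L2_set_le_sum_abs[of "Poly_Mapping.lookup f" "{..<m}"] f(2) by linarith
    finally show ?thesis .
  qed
  then have "(\<Sum>\<pi>\<in>perms m. error m n 0 f \<pi>) \<le> (\<Sum>\<pi>\<in>perms m. 1)"
    by (rule sum_mono)
  then show "(\<Sum>\<pi>\<in>perms m. error m n 0 f \<pi>) \<le> 1 * fact m"
    by simp
qed

lemma sum_error_square_le:
  assumes f: "f \<in> vecs (lp 1 m)" "(\<Sum>i<m. \<bar>Poly_Mapping.lookup f i\<bar>) \<le> 1"
    and "k > 0" "k * (2 * J + 1) \<le> n"
    and N: "N = k * width J 0" "m \<le> N"
  shows "(\<Sum>\<pi>\<in>perms N. (error m n J f \<pi>)\<^sup>2) \<le> 16 / k * fact N"
proof -
  define x where "x = Poly_Mapping.lookup f"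
  have "(\<Sum>\<pi>\<in>perms N. (error m n J f \<pi>)\<^sup>2) \<le>
      (\<Sum>\<pi>\<in>perms N. \<Sum>i<m. if lost m J \<pi> f i then (x i)\<^sup>2 else 0)"
  proof (rule sum_mono)
    fix \<pi> assume \<pi>: "\<pi> \<in> perms N"
    then have inj: "inj \<pi>"
      by (simp add: perms_def permutes_inj)
    have "(recovered n J \<pi> (answers m n J \<pi> f) i - x i)\<^sup>2 \<le> (if lost m J \<pi> f i then (x i)\<^sup>2 else 0)"
      if i: "i < m" for i
    proof (cases "lost m J \<pi> f i")
      case True
      then show ?thesis
        using recovered_eq(1)[OF f(1) i inj, of n J] by (auto simp: x_def)
    next
      case False
      have "\<pi> i < k * width J 0"
        using permutes_in_image[of \<pi> "{..<N}" i] \<pi> i N by (simp add: perms_def)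
      then have "\<pi> i div width J 0 + 1 \<le> k"
        by (simp add: less_mult_imp_div_less Suc_le_eq)
      then have "(\<pi> i div width J 0 + 1) * (2 * J + 1) \<le> n"
        using assms(4) by (meson le_trans mult_le_mono1)
      then have "\<pi> i div width J 0 * (2 * J + 1) + 2 * J < n"
        by simp
      then show ?thesis
        using recovered_eq(2)[OF f(1) i inj False] by (simp add: x_def False)
    qed
    then show "(error m n J f \<pi>)\<^sup>2 \<le> (\<Sum>i<m. if lost m J \<pi> f i then (x i)\<^sup>2 else 0)"
      by (auto simp: error_def sum_nonneg x_def intro!: sum_mono)
  qed
  also have "\<dots> = (\<Sum>i<m. \<Sum>\<pi>\<in>perms N. if lost m J \<pi> f i then (x i)\<^sup>2 else 0)"
    by (rule sum.swap)
  also have "\<dots> = (\<Sum>i<m. \<bar>x i\<bar> * (\<bar>x i\<bar> * real (card {\<pi> \<in> perms N. lost m J \<pi> f i})))"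
    by (simp only: sum.inter_filter[OF finite_perms, symmetric] sum_constant)
      (simp add: power2_eq_square mult_ac abs_mult_self_eq flip: mult.assoc)
  also have "\<dots> \<le> (\<Sum>i<m. \<bar>x i\<bar> * (16 / k * fact N))"
    unfolding x_def using assms by (intro sum_mono mult_left_mono card_lost_le) auto
  also have "\<dots> = (\<Sum>i<m. \<bar>x i\<bar>) * (16 / k * fact N)"
    by (rule sum_distrib_right[symmetric])
  also have "\<dots> \<le> 1 * (16 / k * fact N)"
    using f(2) by (intro mult_right_mono) (auto simp: x_def)
  finally show ?thesis
    by simp
qed

lemma e_ran_id_le_sqrt:
  assumes "k > 0" "k * (2 * J + 1) \<le> n" "m \<le> k * 2 ^ depth J"
  shows "e_ran_id n 1 2 m \<le> ennreal (4 / sqrt k)"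
proof (rule e_ran_id_le_average[where N = "k * width J 0" and J = J])
  fix f assume f: "f \<in> vecs (lp 1 m)" "(\<Sum>i<m. \<bar>Poly_Mapping.lookup f i\<bar>) \<le> 1"
  define N where "N = k * width J 0"
  have "m \<le> N"
    using assms(3) width_0[of J J] by (simp add: N_def)
  have "(\<Sum>\<pi>\<in>perms N. error m n J f \<pi>)\<^sup>2 \<le> (\<Sum>\<pi>\<in>perms N. (error m n J f \<pi>)\<^sup>2) * card (perms N)"
    by (rule sum_squared_le_sum_of_squares)
  also have "\<dots> \<le> (16 / k * fact N) * card (perms N)"
    using sum_error_square_le[OF f assms(1,2) N_def \<open>m \<le> N\<close>] by (intro mult_right_mono) auto
  also have "\<dots> = (4 / sqrt k * fact N)\<^sup>2"
    by (simp add: power_mult_distrib power_divide) (simp add: power2_eq_square)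
  finally have "(\<Sum>\<pi>\<in>perms N. error m n J f \<pi>) \<le> 4 / sqrt k * fact N"
    by (rule power2_le_imp_le) simp
  then show "(\<Sum>\<pi>\<in>perms (k * width J 0). error m n J f \<pi>) \<le> 4 / sqrt k * fact (k * width J 0)"
    by (simp only: N_def)
qed

section \<open>Choice of the parameters\<close>

theorem theorem3p1:
  shows "\<exists>c K :: real. c > 0 \<and> K > 0 \<and>
    (\<forall>n m :: nat. n \<ge> 1 \<and> m \<ge> 1 \<and> real m \<ge> c * real n \<longrightarrow>
       ln (ln (real m / real n)) > 0 \<and>
       e_ran_id n 1 2 m \<le> ennreal (K * sqrt (ln (ln (real m / real n)) / real n)))"
proof (rule exI[of _ "exp 3"], rule exI[of _ 20], rule conjI[OF exp_gt_zero], rule conjI, simp, intro allI impI)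
  fix n m :: nat
  assume "n \<ge> 1 \<and> m \<ge> 1 \<and> real m \<ge> exp 3 * real n"
  then have n: "n \<ge> 1" and m: "real m \<ge> exp 3 * real n"
    by auto
  define r where "r = real m / real n"
  define t where "t = ln r"
  define L where "L = ln t"
  have r: "r \<ge> exp 3"
    using n m by (simp add: r_def field_simps)
  then have r0: "r > 0"
    using exp_gt_zero[of 3] by linarith
  have t: "t \<ge> 3"
    unfolding t_def using r r0 by (simp add: ln_ge_iff)
  have L: "L \<ge> 1"
    unfolding L_def using t exp_le by (simp add: ln_ge_iff)
  then have pos: "ln (ln (real m / real n)) > 0"
    by (simp add: L_def t_def r_def)
  \<comment> \<open>The factor 3 ensures \<open>3 * ln 2 \<ge> 2\<close>, which is used for \<open>2 ^ J \<ge> t\<^sup>2\<close> below.\<close>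
  define J where "J = nat \<lceil>3 * L\<rceil>"
  define q where "q = 2 * J + 1"
  define k where "k = n div q"
  have J: "real J \<ge> 3 * L" "real J \<le> 3 * L + 1"
    using L unfolding J_def by linarith+
  have q: "real q \<le> 9 * L"
    using J L by (simp add: q_def)
  have "e_ran_id n 1 2 m \<le> ennreal (20 * sqrt (L / n))"
  proof (cases "k = 0")
    case True
    then have "n < q"
      by (simp add: k_def q_def div_eq_0_iff)
    then have "real n < 9 * L"
      using q by linarith
    then have "1 \<le> 400 * (L / n)"
      using n L by (simp add: field_simps)
    then have "sqrt 1 \<le> sqrt (20\<^sup>2 * (L / n))"
      by (intro real_sqrt_le_mono) simp
    then have "1 \<le> 20 * sqrt (L / n)"
      by (simp only: real_sqrt_mult) simp
    then show ?thesis
      using e_ran_id_le_1 ennreal_leI order_trans by blast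
  next
    case False
    have "n < (k + 1) * q"
      unfolding k_def using dividend_less_div_times[of q n] by (simp add: q_def)
    also have "\<dots> \<le> (2 * k) * q"
      using False by (intro mult_right_mono) auto
    finally have "real n \<le> real (2 * k * q)"
      by (simp only: of_nat_le_iff)
    then have nk: "real n \<le> 2 * real k * real q"
      by simp
    \<comment> \<open>The depth suffices because \<open>2 ^ J \<ge> t\<^sup>2\<close> and hence \<open>2 ^ 2 ^ J \<ge> r\<^sup>2\<close>.\<close>
    have "t\<^sup>2 = exp (2 * L)"
      using t by (simp add: L_def exp_double)
    also have "\<dots> \<le> exp (real J * ln 2)"
    proof -
      have "2 * L \<le> (3 * L) * ln 2"
        using ln2_ge_two_thirds L by simp
      also have "\<dots> \<le> real J * ln 2"
        using J by (intro mult_right_mono) auto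
      finally show ?thesis
        by simp
    qed
    also have "\<dots> = 2 ^ J"
      by (simp add: exp_of_nat_mult)
    finally have t2: "t\<^sup>2 \<le> 2 ^ J" .
    have "r\<^sup>2 = exp (2 * t)"
      using r0 by (simp add: t_def exp_double)
    also have "\<dots> \<le> exp (real (2 ^ J) * ln 2)"
    proof -
      have "2 * t \<le> t\<^sup>2 * (2 / 3)"
        using t by (simp add: power2_eq_square)
      also have "\<dots> \<le> 2 ^ J * ln 2"
        using t2 ln2_ge_two_thirds by (intro mult_mono) auto
      finally show ?thesis
        by simp
    qed
    also have "\<dots> = 2 ^ 2 ^ J"
      by (simp only: exp_of_nat_mult) simp
    finally have r2: "r\<^sup>2 \<le> 2 ^ 2 ^ J" .
    have "(1 + 1) ^ 3 \<le> exp (1 :: real) ^ 3"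
      using exp_ge_add_one_self[of 1] by (intro power_mono) auto
    then have "exp (3 :: real) \<ge> 8"
      by (simp flip: exp_of_nat_mult)
    then have r8: "8 \<le> r"
      using r by linarith
    have "8 * (real J + 1) \<le> r * 2 ^ J"
    proof (intro mult_mono)
      have "J + 1 \<le> 2 ^ J"
        by (simp add: Suc_le_eq)
      then have "real (J + 1) \<le> real (2 ^ J)"
        by (simp only: of_nat_le_iff)
      then show "real J + 1 \<le> 2 ^ J"
        by simp
    qed (use r8 in auto)
    then have "4 * real q \<le> r * 2 ^ J"
      by (simp add: q_def)
    then have "r * (4 * real q) \<le> r * (r * 2 ^ J)"
      using r0 by (intro mult_left_mono) auto
    also have "\<dots> = r\<^sup>2 * 2 ^ J"
      by (simp add: power2_eq_square)
    also have "\<dots> \<le> 2 ^ 2 ^ J * 2 ^ J"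
      by (intro mult_right_mono r2) auto
    also have "\<dots> = 2 * 2 ^ depth J"
    proof -
      have "Suc (depth J) = 2 ^ J + J"
        by (simp add: depth_def)
      then show ?thesis
        by (metis power_Suc power_add)
    qed
    finally have depth: "2 * r * real q \<le> 2 ^ depth J"
      by simp
    have "real m = r * real n"
      using n by (simp add: r_def)
    also have "\<dots> \<le> r * (2 * real k * real q)"
      using r0 nk by (intro mult_left_mono) auto
    also have "\<dots> \<le> real k * 2 ^ depth J"
      using mult_left_mono[OF depth, of "real k"] by (simp add: mult_ac)
    finally have "real m \<le> real (k * 2 ^ depth J)"
      by simp
    then have "m \<le> k * 2 ^ depth J"
      by (simp only: of_nat_le_iff)
    then have "e_ran_id n 1 2 m \<le> ennreal (4 / sqrt k)"
      using False by (intro e_ran_id_le_sqrt[of k J]) (auto simp only: k_def q_def[symmetric] div_times_less_eq_dividend)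
    also have "\<dots> \<le> ennreal (20 * sqrt (L / n))"
    proof (rule ennreal_leI)
      have "real n \<le> 2 * real k * (9 * L)"
        using nk mult_left_mono[OF q, of "2 * real k"] by linarith
      moreover have "real k * L \<ge> 0"
        using L by simp
      ultimately have "real n * 16 \<le> 400 * (real k * L)"
        by linarith
      then have "16 / real k \<le> 400 * (L / n)"
        using False n by (simp add: field_simps)
      then have "sqrt (4\<^sup>2 / real k) \<le> sqrt (20\<^sup>2 * (L / n))"
        by (intro real_sqrt_le_mono) simp
      then show "4 / sqrt k \<le> 20 * sqrt (L / n)"
        by (simp only: real_sqrt_mult[of "20\<^sup>2"] real_sqrt_divide[of "4\<^sup>2"]) simp
    qed
    finally show ?thesis .
  qed
  with pos show "ln (ln (real m / real n)) > 0 \<and>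
      e_ran_id n 1 2 m \<le> ennreal (20 * sqrt (ln (ln (real m / real n)) / real n))"
    by (simp add: L_def t_def r_def)
qed

end
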